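(* Let $b$ be a connected graph over a countable discrete set $X$ and let $K\subseteq X$ be a non-empty subset with $K\neq X$. Suppose that $u\in\mathcal{F}$ is strictly positive on $X\setminus K$, $u=0$ on $K$, and $\mathcal{L}u=0$ on $X\setminus K$. If $u$ is additionally proper and satisfies $$\sum_{x,y\in X,\ u(y)<t_0\le u(x)}b(x,y)\big(u(x)-u(y)\big)<\infty$$ for some $t_0>0$, then $w\colon X\setminus K\to[0,\infty)$ given by $$w=\frac{\mathcal{L}u^{1/2}}{u^{1/2}}$$ is a null-critical Hardy weight on $X\setminus K$.
   Context: A graph $b$ over a countable discrete set $X$ is a symmetric function $b\colon X\times X\to[0,\infty)$ with zero diagonal and $\sum_{y\in X}b(x,y)<\infty$ for every $x\in X$ (local finiteness is not assumed). It is connected if for all $x,y\in X$ there are $x=y_1,\dots,y_n=y$ with $b(y_i,y_{i+1})>0$ for all $1\le i\le n-1$. $\mathcal{F}$ is the set of $f\colon X\to\mathbb{R}$ with $\sum_{y}b(x,y)|f(y)|<\infty$ for all $x$, and for $f\in\mathcal{F}$, $\mathcal{L}f(x)=\sum_{y\in X}b(x,y)(f(x)-f(y))$. For finitely supported $\varphi\colon X\to\mathbb{R}$, $\mathcal{Q}(\varphi)=\frac12\sum_{x,y\in X}b(x,y)(\varphi(x)-\varphi(y))^2$. A function $u\colon X\to[0,\infty)$ is proper if $u^{-1}(I)$ is finite for every compact interval $I\subseteq(0,\infty)$. Hardy weights: for $Y\subseteq X$, a non-trivial function $w\colon Y\to[0,\infty)$ is a Hardy weight on $Y$ if $\mathcal{Q}(\varphi)\ge\sum_{x\in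 Y}w(x)\varphi(x)^2$ for all finitely supported $\varphi$ vanishing outside $Y$. A Hardy weight $w$ on $Y$ is critical if every Hardy weight $w'\ge w$ on $Y$ satisfies $w'=w$. In this case there exists a function $v\in\mathcal{F}$ positive on $Y$, vanishing outside $Y$, with $\mathcal{L}v=wv$ on $Y$, called an (Agmon) ground state (unique up to scalar multiples when the restriction of the graph to $Y$ is connected). A critical Hardy weight $w$ is null-critical if $\sum_{x\in Y}w(x)v(x)^2=\infty$ for every ground state $v$. *)

theory Defs
  imports "HOL-Analysis.Analysis"
begin

text \<open>
  The vertex set is a type of class \<open>countable\<close>. Where a sum is required to be finite or infinite,
  its terms are nonnegative, so that this is expressed by \<open>summable_on\<close> and its negation.
\<close>

definition weighted_graph :: "('a::countable \<Rightarrow> 'a \<Rightarrow> real) \<Rightarrow> bool" where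
  "weighted_graph b \<longleftrightarrow>
     (\<forall>x y. 0 \<le> b x y) \<and> (\<forall>x y. b x y = b y x) \<and> (\<forall>x. b x x = 0) \<and>
     (\<forall>x. (\<lambda>y. b x y) summable_on UNIV)"

definition connected_graph :: "('a::countable \<Rightarrow> 'a \<Rightarrow> real) \<Rightarrow> bool" where
  "connected_graph b \<longleftrightarrow>
     (\<forall>x y. \<exists>ys. ys \<noteq> [] \<and> hd ys = x \<and> last ys = y \<and> successively (\<lambda>z z'. b z z' > 0) ys)"

definition formal_domain :: "('a::countable \<Rightarrow> 'a \<Rightarrow> real) \<Rightarrow> ('a \<Rightarrow> real) set" where
  "formal_domain b = {f. \<forall>x. (\<lambda>y. b x y * \<bar>f y\<bar>) summable_on UNIV}"

text \<open>The value is meaningful only for \<open>f \<in> formal_domain b\<close>, where the sum converges absolutely.\<close>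

definition laplacian :: "('a::countable \<Rightarrow> 'a \<Rightarrow> real) \<Rightarrow> ('a \<Rightarrow> real) \<Rightarrow> 'a \<Rightarrow> real" where
  "laplacian b f x = (\<Sum>\<^sub>\<infinity>y\<in>UNIV. b x y * (f x - f y))"

text \<open>The energy is used for finitely supported functions only, where the sum converges.\<close>

definition energy :: "('a::countable \<Rightarrow> 'a \<Rightarrow> real) \<Rightarrow> ('a \<Rightarrow> real) \<Rightarrow> real" where
  "energy b \<phi> = (1/2) * (\<Sum>\<^sub>\<infinity>(x, y)\<in>UNIV. b x y * (\<phi> x - \<phi> y)\<^sup>2)"

definition proper_function :: "('a::countable \<Rightarrow> real) \<Rightarrow> bool" where
  "proper_function u \<longleftrightarrow>
     (\<forall>I. compact I \<and> is_interval I \<and> I \<subseteq> {0<..} \<longrightarrow> finite (u -` I))"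

text \<open>A function on \<open>Y\<close> is a total function of which only the values on \<open>Y\<close> are used.\<close>

definition hardy_weight ::
  "('a::countable \<Rightarrow> 'a \<Rightarrow> real) \<Rightarrow> 'a set \<Rightarrow> ('a \<Rightarrow> real) \<Rightarrow> bool" where
  "hardy_weight b Y w \<longleftrightarrow>
     (\<forall>x\<in>Y. 0 \<le> w x) \<and> (\<exists>x\<in>Y. w x \<noteq> 0) \<and>
     (\<forall>\<phi>. finite {x. \<phi> x \<noteq> 0} \<and> (\<forall>x. x \<notin> Y \<longrightarrow> \<phi> x = 0) \<longrightarrow>
        energy b \<phi> \<ge> (\<Sum>\<^sub>\<infinity>x\<in>Y. w x * (\<phi> x)\<^sup>2))"

definition critical_hardy_weight ::
  "('a::countable \<Rightarrow> 'a \<Rightarrow> real) \<Rightarrow> 'a set \<Rightarrow> ('a \<Rightarrow> real) \<Rightarrow> bool" where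
  "critical_hardy_weight b Y w \<longleftrightarrow>
     hardy_weight b Y w \<and>
     (\<forall>w'. hardy_weight b Y w' \<and> (\<forall>x\<in>Y. w x \<le> w' x) \<longrightarrow> (\<forall>x\<in>Y. w' x = w x))"

definition ground_state ::
  "('a::countable \<Rightarrow> 'a \<Rightarrow> real) \<Rightarrow> 'a set \<Rightarrow> ('a \<Rightarrow> real) \<Rightarrow> ('a \<Rightarrow> real) \<Rightarrow> bool" where
  "ground_state b Y w v \<longleftrightarrow>
     v \<in> formal_domain b \<and> (\<forall>x\<in>Y. 0 < v x) \<and> (\<forall>x. x \<notin> Y \<longrightarrow> v x = 0) \<and>
     (\<forall>x\<in>Y. laplacian b v x = w x * v x)"

definition null_critical_hardy_weight ::
  "('a::countable \<Rightarrow> 'a \<Rightarrow> real) \<Rightarrow> 'a set \<Rightarrow> ('a \<Rightarrow> real) \<Rightarrow> bool" where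
  "null_critical_hardy_weight b Y w \<longleftrightarrow>
     critical_hardy_weight b Y w \<and>
     (\<forall>v. ground_state b Y w v \<longrightarrow> \<not> (\<lambda>x. w x * (v x)\<^sup>2) summable_on Y)"

end

theory Submission
  imports Defs
begin

text \<open>
  Write \<open>Y = X - K\<close> and \<open>v = sqrt u\<close>. By the very definition of \<open>w\<close>, \<open>v\<close> is a ground state of \<open>w\<close>, so
  the ground state representation (\<open>ground_state_representation\<close>)

    \<open>Q(\<phi>) - \<Sum>\<^sub>Y w \<phi>\<^sup>2 = 1/2 \<Sum>\<^bsub>x,y\<^esub> b(x,y) v(x) v(y) (\<phi>(x)/v(x) - \<phi>(y)/v(y))\<^sup>2\<close>

  gives the Hardy inequality. That \<open>w\<close> is nonnegative and not \<open>0\<close> follows from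
  \<open>w v\<^sup>2 = 1/2 \<Sum>\<^sub>y b(\<cdot>,y) (v - v y)\<^sup>2\<close> on \<open>Y\<close> (\<open>has_sum_sqrt_harmonic\<close>). All remaining claims rest on one null sequence: finitely supported
  \<open>0 \<le> e\<^sub>n \<le> v\<close> with \<open>e\<^sub>n \<longlonglongrightarrow> v\<close> pointwise for which the left-hand side, the Hardy deficit, tends to \<open>0\<close>.

  The null sequence is \<open>e\<^sub>n = v (1 - \<bar>c\<^sub>n(u)\<bar> / n)\<close> with \<open>c\<^sub>n\<close> the logarithm clamped to \<open>[-n, n]\<close>; its
  supports are finite since \<open>u\<close> is proper. As the logarithmic mean dominates the geometric mean,
  \<open>sqrt (s t) (c\<^sub>n s - c\<^sub>n t)\<^sup>2 \<le> (s - t) (c\<^sub>n s - c\<^sub>n t)\<close>, so the deficit is at most \<open>1/(2 n\<^sup>2)\<close> times the sum of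
  \<open>b(x,y) (u x - u y) (c\<^sub>n(u x) - c\<^sub>n(u y))\<close>. Now \<open>c\<^sub>n(u)\<close> is a finitely supported function plus a
  constant plus \<open>2n\<close> times the indicator of \<open>{u \<ge> t\<^sub>0}\<close>. The finitely supported part contributes nothing
  because \<open>u\<close> is harmonic, and the step contributes \<open>4 n C\<close>, where \<open>C\<close> is the flux of \<open>u\<close> through the
  level \<open>t\<^sub>0\<close>. The deficit is therefore at most \<open>2 C / n\<close> (\<open>flux_formula\<close>, \<open>null_sequence_log_cutoff\<close>).

  \<^item> Criticality: inserting \<open>e\<^sub>n\<close> in the Hardy inequality for \<open>w' \<ge> w\<close> forces \<open>(w' - w) v\<^sup>2 \<le> 0\<close>.

  \<^item> Ground states: inserting \<open>e\<^sub>n\<close> in the representation with respect to another ground state \<open>V\<close>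
    shows that \<open>V / v\<close> does not change along edges inside \<open>Y\<close>. As \<open>Y\<close> may be disconnected, it may
    still take infinitely many values; replacing \<open>V\<close> by the smaller \<open>v' = min(1, V/v) v\<close> brings it
    below \<open>v\<close>, and \<open>min(1, V/v) e\<^sub>n\<close> is a null sequence converging to \<open>v'\<close>.

  \<^item> Null-criticality: if \<open>\<Sum> w V\<^sup>2\<close> were finite, so would be \<open>\<Sum> w v'\<^sup>2\<close>, and Fatou's lemma along the null
    sequence would give \<open>1/2 \<Sum>\<^bsub>x,y \<in> X\<^esub> b(x,y) (v' x - v' y)\<^sup>2 \<le> \<Sum> w v'\<^sup>2\<close>. But harmonicity of \<open>u\<close> gives
    \<open>w v'\<^sup>2 = 1/2 \<Sum>\<^sub>y b(\<cdot>,y) (v' - v' y)\<^sup>2\<close> on \<open>Y\<close>, so that the right-hand side is the same sum with \<open>x\<close>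
    restricted to \<open>Y\<close>. Hence the terms with \<open>x \<in> K\<close> vanish, which contradicts the existence of an
    edge between \<open>K\<close> and \<open>Y\<close>.
\<close>

section \<open>Green's formula and the ground state representation\<close>

lemma has_sum_eqI:
  assumes "(f has_sum s) A" "\<And>x. x \<in> A \<Longrightarrow> f x = g x" "s = t"
  shows "(g has_sum t) A"
  using assms has_sum_cong[of A f g] by blast

lemma weighted_graphD:
  assumes "weighted_graph b"
  shows weighted_graph_nonneg: "0 \<le> b x y"
    and weighted_graph_sym: "b x y = b y x"
    and weighted_graph_summable: "(\<lambda>y. b x y) summable_on UNIV"
  using assms by (auto simp: weighted_graph_def)

lemma has_sum_laplacian:
  assumes b: "weighted_graph b" and v: "v \<in> formal_domain b"
  shows "((\<lambda>y. b x y * (v x - v y)) has_sum laplacian b v x) UNIV"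
proof -
  have "(\<lambda>y. \<bar>b x y * v y\<bar>) summable_on UNIV"
    using v weighted_graph_nonneg[OF b, of x] by (simp add: formal_domain_def abs_mult)
  then have 1: "(\<lambda>y. b x y * v y) summable_on UNIV"
    by (subst summable_on_iff_abs_summable_on_real) simp
  have "(\<lambda>y. b x y * v x - b x y * v y) summable_on UNIV"
    using summable_on_add[OF summable_on_cmult_left[OF weighted_graph_summable[OF b]]
        iffD2[OF summable_on_uminus 1]] by simp
  then show ?thesis
    by (simp add: laplacian_def right_diff_distrib)
qed

lemma formal_domain_finite_support:
  assumes "finite {x. \<phi> x \<noteq> 0}"
  shows "\<phi> \<in> formal_domain b"
  unfolding formal_domain_def mem_Collect_eq
proof
  fix x
  show "(\<lambda>y. b x y * \<bar>\<phi> y\<bar>) summable_on UNIV"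
    by (rule finite_nonzero_values_imp_summable_on) (rule finite_subset[OF _ assms], auto)
qed

lemma sqrt_in_formal_domain:
  assumes b: "weighted_graph b" and u: "u \<in> formal_domain b"
  shows "(\<lambda>x. sqrt (u x)) \<in> formal_domain b"
  unfolding formal_domain_def mem_Collect_eq
proof
  fix x
  have "(\<lambda>y. b x y + b x y * \<bar>u y\<bar>) summable_on UNIV"
    using u weighted_graph_summable[OF b] by (intro summable_on_add) (auto simp: formal_domain_def)
  moreover have "b x y * \<bar>sqrt (u y)\<bar> \<le> b x y + b x y * \<bar>u y\<bar>" for y
  proof -
    have "\<bar>sqrt (u y)\<bar> \<le> 1 + \<bar>u y\<bar>"
    proof -
      have "sqrt \<bar>u y\<bar> \<le> 1 + \<bar>u y\<bar>"
        by (rule real_le_lsqrt) (auto simp: power2_eq_square algebra_simps)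
      moreover have "\<bar>sqrt (u y)\<bar> = sqrt \<bar>u y\<bar>"
        by (cases "0 \<le> u y") (simp_all add: real_sqrt_minus)
      ultimately show ?thesis by simp
    qed
    from mult_left_mono[OF this weighted_graph_nonneg[OF b, of x y]] show ?thesis
      by (simp add: distrib_left)
  qed
  ultimately show "(\<lambda>y. b x y * \<bar>sqrt (u y)\<bar>) summable_on UNIV"
    by (rule summable_on_comparison_test) (use weighted_graph_nonneg[OF b] in auto)
qed

text \<open>
  For finitely supported \<open>g\<close> the double sum splits into two absolutely convergent ones, supported on
  finitely many rows and on finitely many columns respectively, and these agree by symmetry of \<open>b\<close>.
\<close>

lemma green_formula:
  assumes b: "weighted_graph b" and v: "v \<in> formal_domain b" and g: "finite {x. g x \<noteq> 0}"
  shows "((\<lambda>(x, y). b x y * (v x - v y) * (g x - g y)) has_sum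
           2 * (\<Sum>x | g x \<noteq> 0. g x * laplacian b v x)) UNIV"
proof -
  let ?S = "{x. g x \<noteq> 0}"
  let ?f = "\<lambda>(x, y). g x * (b x y * (v x - v y))"
  have "(?f has_sum g x * laplacian b v x) ({x} \<times> UNIV)" for x
  proof -
    have "((\<lambda>y. g x * (b x y * (v x - v y))) has_sum g x * laplacian b v x) UNIV"
      by (intro has_sum_cmult_right has_sum_laplacian[OF b v])
    moreover have "bij_betw (Pair x) UNIV ({x} \<times> UNIV)"
      by (auto simp: bij_betw_def inj_on_def)
    from has_sum_reindex_bij_betw[OF this, where f = ?f]
    have "((\<lambda>y. g x * (b x y * (v x - v y))) has_sum s) UNIV = (?f has_sum s) ({x} \<times> UNIV)" for s
      by simp
    ultimately show ?thesis
      by blast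
  qed
  then have "(?f has_sum (\<Sum>x\<in>?S. g x * laplacian b v x)) (\<Union>x\<in>?S. {x} \<times> UNIV)"
    by (intro sum_has_sum) (use g in auto)
  then have rows: "(?f has_sum (\<Sum>x\<in>?S. g x * laplacian b v x)) (UNIV \<times> UNIV)"
    by (rule has_sum_cong_neutral[THEN iffD1, rotated 3]) auto
  show ?thesis
  proof (rule has_sum_eqI[OF has_sum_add[OF rows has_sum_swap[THEN iffD1, OF rows],
        unfolded UNIV_Times_UNIV]])
    fix p :: "'a \<times> 'a"
    obtain x y where p: "p = (x, y)"
      by (cases p)
    show "?f p + (\<lambda>(x, y). ?f (y, x)) p = (\<lambda>(x, y). b x y * (v x - v y) * (g x - g y)) p"
      unfolding p prod.case weighted_graph_sym[OF b, of y x] by (simp add: algebra_simps)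
  qed simp
qed

lemma has_sum_energy:
  assumes b: "weighted_graph b" and fin: "finite {x. \<phi> x \<noteq> 0}"
  shows "((\<lambda>(x, y). b x y * (\<phi> x - \<phi> y)\<^sup>2) has_sum 2 * energy b \<phi>) UNIV"
proof -
  have "(\<lambda>(x, y). b x y * (\<phi> x - \<phi> y)\<^sup>2) summable_on UNIV"
    using green_formula[OF b formal_domain_finite_support[OF fin] fin, THEN has_sum_imp_summable]
    by (simp add: power2_eq_square mult.assoc)
  then show ?thesis
    by (simp add: energy_def)
qed

text \<open>
  With \<open>f = \<phi> / v\<close> the identity is Green's formula for \<open>v\<close> and \<open>v f\<^sup>2\<close>, since
  \<open>(\<phi> x - \<phi> y)\<^sup>2 - v x v y (f x - f y)\<^sup>2 = (v x - v y) (v x (f x)\<^sup>2 - v y (f y)\<^sup>2)\<close>. Off \<open>Y\<close>, where \<open>\<phi> / v\<close>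
  takes the default value of a division by \<open>0\<close>, it is multiplied by \<open>v = 0\<close>.
\<close>

lemma ground_state_representation:
  assumes b: "weighted_graph b" and v: "ground_state b Y w v"
    and fin: "finite {x. \<phi> x \<noteq> 0}" and off: "\<And>x. x \<notin> Y \<Longrightarrow> \<phi> x = 0"
  shows "((\<lambda>(x, y). b x y * (v x * v y) * (\<phi> x / v x - \<phi> y / v y)\<^sup>2) has_sum
           2 * (energy b \<phi> - (\<Sum>\<^sub>\<infinity>x\<in>Y. w x * (\<phi> x)\<^sup>2))) UNIV"
proof -
  let ?S = "{x. \<phi> x \<noteq> 0}"
  define f where "f x = \<phi> x / v x" for x
  define g where "g x = v x * (f x)\<^sup>2" for x
  have vdom: "v \<in> formal_domain b" and pos: "\<And>x. x \<in> Y \<Longrightarrow> 0 < v x"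
    and eq: "\<And>x. x \<in> Y \<Longrightarrow> laplacian b v x = w x * v x"
    using v by (auto simp: ground_state_def)
  have \<phi>: "\<phi> x = v x * f x" for x
    using pos[of x] off[of x] by (cases "x \<in> Y") (auto simp: f_def)
  have supp: "{x. g x \<noteq> 0} = ?S"
    using \<phi> by (auto simp: g_def)
  have SY: "?S \<subseteq> Y"
    using off by auto
  have 1: "((\<lambda>(x, y). b x y * (\<phi> x - \<phi> y)\<^sup>2) has_sum 2 * energy b \<phi>) UNIV"
    by (rule has_sum_energy[OF b fin])
  have "(\<Sum>x\<in>?S. g x * laplacian b v x) = (\<Sum>x\<in>?S. w x * (\<phi> x)\<^sup>2)"
    using SY by (intro sum.cong) (auto simp: g_def eq \<phi> power2_eq_square)
  also have "\<dots> = (\<Sum>\<^sub>\<infinity>x\<in>?S. w x * (\<phi> x)\<^sup>2)"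
    using fin by simp
  also have "\<dots> = (\<Sum>\<^sub>\<infinity>x\<in>Y. w x * (\<phi> x)\<^sup>2)"
    using SY by (intro infsum_cong_neutral) auto
  finally have 2: "((\<lambda>(x, y). b x y * (v x - v y) * (g x - g y)) has_sum
          2 * (\<Sum>\<^sub>\<infinity>x\<in>Y. w x * (\<phi> x)\<^sup>2)) UNIV"
    using green_formula[OF b vdom, of g] fin by (simp add: supp)
  show ?thesis
    using has_sum_add[OF 1 has_sum_uminusI[OF 2]]
    by (rule has_sum_eqI) (auto simp: algebra_simps power2_eq_square \<phi> g_def simp flip: f_def)
qed

text \<open>The Hardy deficit is a sum of squares in the ground state representation.\<close>

lemma hardy_weight_if_ground_state:
  assumes b: "weighted_graph b" and v: "ground_state b Y w v"
    and w: "\<And>x. x \<in> Y \<Longrightarrow> 0 \<le> w x" "\<exists>x\<in>Y. w x \<noteq> 0"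
  shows "hardy_weight b Y w"
  unfolding hardy_weight_def
proof (intro conjI ballI allI impI)
  have v0: "0 \<le> v x" for x
    using v by (cases "x \<in> Y") (auto simp: ground_state_def less_imp_le)
  fix \<phi> :: "'a \<Rightarrow> real" assume "finite {x. \<phi> x \<noteq> 0} \<and> (\<forall>x. x \<notin> Y \<longrightarrow> \<phi> x = 0)"
  then have "0 \<le> 2 * (energy b \<phi> - (\<Sum>\<^sub>\<infinity>x\<in>Y. w x * (\<phi> x)\<^sup>2))"
    by (intro has_sum_nonneg[OF ground_state_representation[OF b v]])
      (auto simp: weighted_graph_nonneg[OF b] v0)
  then show "(\<Sum>\<^sub>\<infinity>x\<in>Y. w x * (\<phi> x)\<^sup>2) \<le> energy b \<phi>"
    by simp
qed (use w in auto)

section \<open>The clamped logarithm\<close>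

text \<open>
  The geometric mean is at most the logarithmic mean. With \<open>q = sqrt (s / t)\<close> this is
  \<open>2 ln q \<le> q - 1 / q\<close>, and the difference of the two sides vanishes at \<open>1\<close> and has derivative \<open>(1 - 1 / q)\<^sup>2\<close>.
\<close>

lemma sqrt_mult_ln_diff_le:
  fixes s t :: real
  assumes "0 < t" "t \<le> s"
  shows "sqrt s * sqrt t * (ln s - ln t) \<le> s - t"
proof -
  define q where "q = sqrt s / sqrt t"
  have q: "1 \<le> q"
    using assms by (simp add: q_def)
  have "1 - 1 / 1 - 2 * ln 1 \<le> q - 1 / q - 2 * ln q"
  proof (rule DERIV_nonneg_imp_nondecreasing[OF q, of "\<lambda>r. r - 1 / r - 2 * ln r"])
    fix r :: real assume "1 \<le> r" "r \<le> q"
    then have "((\<lambda>r. r - 1 / r - 2 * ln r) has_real_derivative (1 - 1 / r)\<^sup>2) (at r)"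
      by (auto intro!: derivative_eq_intros simp: field_simps power2_eq_square)
    then show "\<exists>d. ((\<lambda>r. r - 1 / r - 2 * ln r) has_real_derivative d) (at r) \<and> 0 \<le> d"
      by (intro exI[of _ "(1 - 1 / r)\<^sup>2"]) simp
  qed
  then have "2 * ln q \<le> q - 1 / q"
    by simp
  moreover have "2 * ln q = ln s - ln t"
    using assms by (simp add: q_def ln_div ln_sqrt)
  ultimately have "sqrt s * sqrt t * (ln s - ln t) \<le> sqrt s * sqrt t * (q - 1 / q)"
    using assms by (intro mult_left_mono) auto
  also have "\<dots> = (sqrt s)\<^sup>2 - (sqrt t)\<^sup>2"
    using assms by (simp add: q_def field_simps power2_eq_square)
  finally show ?thesis
    using assms by simp
qed

text \<open>
  The argument is clamped, and not the value, in order to have a monotone function on the whole real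
  line: at \<open>0\<close>, the value of \<open>u\<close> on \<open>K\<close>, it has to be \<open>- n\<close>, whereas the
  default value of \<open>ln 0\<close> is \<open>0\<close>.
\<close>

definition clamped_ln :: "real \<Rightarrow> real \<Rightarrow> real" where
  "clamped_ln n t = ln (max (exp (- n)) (min (exp n) t))"

lemma clamped_ln_mono:
  assumes "s \<le> t"
  shows "clamped_ln n s \<le> clamped_ln n t"
  unfolding clamped_ln_def using assms by (subst ln_le_cancel_iff) (auto simp: less_max_iff_disj)

lemma clamped_ln_eq:
  assumes "0 < t"
  shows "clamped_ln n t = max (- n) (min n (ln t))"
proof -
  obtain r where "t = exp r"
    using assms exp_ln by metis
  then show ?thesis
    by (auto simp: clamped_ln_def max_def min_def)
qed

lemma clamped_ln_below: "n \<ge> 0 \<Longrightarrow> t \<le> exp (- n) \<Longrightarrow> clamped_ln n t = - n"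
  by (simp add: clamped_ln_def min.coboundedI2 max.absorb1)

lemma clamped_ln_above: "n \<ge> 0 \<Longrightarrow> exp n \<le> t \<Longrightarrow> clamped_ln n t = n"
  by (simp add: clamped_ln_def max.absorb2 min.absorb1)

text \<open>
  One factor of the squared increment is bounded by the increment of the logarithm; the geometric
  mean turns this factor into \<open>s - t\<close>. The other factor is kept, and the resulting bound is linear in
  the clamped logarithm, which makes it accessible to Green's formula.
\<close>

lemma sqrt_mult_clamped_ln_diff_le:
  assumes "0 \<le> s" "0 \<le> t"
  shows "sqrt s * sqrt t * (\<bar>clamped_ln n s\<bar> - \<bar>clamped_ln n t\<bar>)\<^sup>2
          \<le> (s - t) * (clamped_ln n s - clamped_ln n t)"
  using assms
proof (induction t s rule: linorder_wlog)
  case (le t s)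
  let ?d = "clamped_ln n s - clamped_ln n t"
  have d: "0 \<le> ?d"
    using clamped_ln_mono[OF le(1)] by simp
  show ?case
  proof (cases "t = 0")
    case True
    then show ?thesis using le d by simp
  next
    case False
    then have t: "0 < t" "0 < s"
      using le by auto
    then have "ln t \<le> ln s"
      using le(1) by simp
    then have ln: "?d \<le> ln s - ln t"
      unfolding clamped_ln_eq[OF t(1)] clamped_ln_eq[OF t(2)] by linarith
    have "(\<bar>clamped_ln n s\<bar> - \<bar>clamped_ln n t\<bar>)\<^sup>2 \<le> ?d\<^sup>2"
      by (rule abs_le_square_iff[THEN iffD1]) auto
    then have "sqrt s * sqrt t * (\<bar>clamped_ln n s\<bar> - \<bar>clamped_ln n t\<bar>)\<^sup>2 \<le> sqrt s * sqrt t * ?d\<^sup>2"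
      using t by (intro mult_left_mono) auto
    also have "\<dots> = (sqrt s * sqrt t * ?d) * ?d"
      by (simp add: power2_eq_square)
    also have "\<dots> \<le> (s - t) * ?d"
    proof (rule mult_right_mono[OF _ d])
      have "sqrt s * sqrt t * ?d \<le> sqrt s * sqrt t * (ln s - ln t)"
        using t ln by (intro mult_left_mono) auto
      also have "\<dots> \<le> s - t"
        by (rule sqrt_mult_ln_diff_le[OF t(1) le(1)])
      finally show "sqrt s * sqrt t * ?d \<le> s - t" .
    qed
    finally show ?thesis .
  qed
next
  case (sym t s)
  then show ?case
    by (metis (no_types, opaque_lifting) minus_diff_eq minus_mult_minus mult.commute power2_commute)
qed

section \<open>The flux through the level sets\<close>

lemma proper_functionD:
  assumes "proper_function u" "0 < a"
  shows "finite {x. a \<le> u x \<and> u x \<le> c}"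
proof -
  have "finite (u -` {a..c})"
    using assms unfolding proper_function_def
    by (metis atLeastAtMost_iff compact_Icc greaterThan_iff is_interval_cc less_le_trans subsetI)
  moreover have "u -` {a..c} = {x. a \<le> u x \<and> u x \<le> c}"
    by auto
  ultimately show ?thesis by simp
qed

text \<open>
  A substitute for the coarea formula. Subtracting \<open>\<alpha>\<close> and a step of height \<open>\<beta> - \<alpha>\<close> at \<open>t0\<close> from \<open>F\<close>
  leaves a function \<open>h\<close> that is supported between two positive levels of \<open>u\<close>, hence finitely
  supported, and Green's formula for \<open>h\<close> gives \<open>0\<close> since \<open>u\<close> is harmonic there. Only the step
  contributes: it counts the flux through \<open>t0\<close> in both orientations of each edge.
\<close>

lemma flux_formula:
  fixes F :: "real \<Rightarrow> real"
  assumes b: "weighted_graph b" and u: "u \<in> formal_domain b" and proper: "proper_function u"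
    and harm: "\<And>x. 0 < u x \<Longrightarrow> laplacian b u x = 0"
    and t0: "0 < t0"
    and flux: "((\<lambda>(x, y). b x y * (u x - u y)) has_sum C) {(x, y). u y < t0 \<and> t0 \<le> u x}"
    and a: "0 < a" "\<And>t. t \<le> a \<Longrightarrow> F t = \<alpha>" and c: "\<And>t. c \<le> t \<Longrightarrow> F t = \<beta>"
  shows "((\<lambda>(x, y). b x y * (u x - u y) * (F (u x) - F (u y))) has_sum 2 * C * (\<beta> - \<alpha>)) UNIV"
proof -
  define step where "step t = (if t0 \<le> t then 1 else 0 :: real)" for t
  define h where "h x = F (u x) - \<alpha> - (\<beta> - \<alpha>) * step (u x)" for x
  have supp: "{x. h x \<noteq> 0} \<subseteq> {x. min a t0 \<le> u x \<and> u x \<le> max c t0}"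
  proof
    fix x assume "x \<in> {x. h x \<noteq> 0}"
    then have "t0 \<le> u x \<and> u x < c \<or> u x < t0 \<and> a < u x"
      using a(2)[of "u x"] c[of "u x"] by (auto simp: h_def step_def not_le[symmetric] split: if_splits)
    then show "x \<in> {x. min a t0 \<le> u x \<and> u x \<le> max c t0}"
      by auto
  qed
  have fin: "finite {x. h x \<noteq> 0}"
    by (rule finite_subset[OF supp proper_functionD[OF proper]]) (use a t0 in auto)
  have "(\<Sum>x | h x \<noteq> 0. h x * laplacian b u x) = 0"
    using supp a(1) t0 harm by (intro sum.neutral) (fastforce simp: min_le_iff_disj)
  then have 1: "((\<lambda>(x, y). b x y * (u x - u y) * (h x - h y)) has_sum 0) UNIV"
    using green_formula[OF b u fin] by simp
  let ?j = "\<lambda>(x, y). b x y * (u x - u y) * (step (u x) - step (u y))"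
  let ?U = "{(x, y). u y < t0 \<and> t0 \<le> u x}" and ?D = "{(x, y). u x < t0 \<and> t0 \<le> u y}"
  have up: "(?j has_sum C) ?U"
    using flux by (rule has_sum_cong[THEN iffD1, rotated]) (auto simp: step_def)
  have "(?j has_sum C) ?D"
    using up by (rule has_sum_reindex_bij_witness[of ?U "\<lambda>(x, y). (y, x)" "\<lambda>(x, y). (y, x)", THEN iffD1, rotated -1])
      (auto simp: weighted_graph_sym[OF b] algebra_simps)
  with up have "(?j has_sum C + C) (?U \<union> ?D)"
    by (intro has_sum_Un_disjoint) auto
  then have 2: "(?j has_sum C + C) UNIV"
    by (rule has_sum_cong_neutral[THEN iffD1, rotated 3]) (auto simp: step_def split: if_splits)
  show ?thesis
    using has_sum_add[OF 1 has_sum_cmult_right[OF 2, of "\<beta> - \<alpha>"]]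
    by (rule has_sum_eqI) (auto simp: h_def algebra_simps)
qed

section \<open>Consequences of a null sequence\<close>

text \<open>
  The domination \<open>e n \<le> v\<close> is part of the notion because it bounds \<open>\<Sum> w (e n)\<^sup>2\<close> by \<open>\<Sum> w v\<^sup>2\<close> in the
  proof of null-criticality.
\<close>

definition null_sequence ::
  "('a::countable \<Rightarrow> 'a \<Rightarrow> real) \<Rightarrow> 'a set \<Rightarrow> ('a \<Rightarrow> real) \<Rightarrow> ('a \<Rightarrow> real) \<Rightarrow> (nat \<Rightarrow> 'a \<Rightarrow> real) \<Rightarrow> bool" where
  "null_sequence b Y w v e \<longleftrightarrow>
     (\<forall>n. finite {x. e n x \<noteq> 0}) \<and> (\<forall>n x. x \<notin> Y \<longrightarrow> e n x = 0) \<and>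
     (\<forall>n x. 0 \<le> e n x \<and> e n x \<le> v x) \<and> (\<forall>x. (\<lambda>n. e n x) \<longlonglongrightarrow> v x) \<and>
     (\<lambda>n. energy b (e n) - (\<Sum>\<^sub>\<infinity>x\<in>Y. w x * (e n x)\<^sup>2)) \<longlonglongrightarrow> 0"

lemma critical_if_null_sequence:
  assumes w: "hardy_weight b Y w" and e: "null_sequence b Y w v e"
    and pos: "\<And>x. x \<in> Y \<Longrightarrow> 0 < v x"
  shows "critical_hardy_weight b Y w"
  unfolding critical_hardy_weight_def
proof (intro conjI allI impI ballI w)
  fix w' x assume w': "hardy_weight b Y w' \<and> (\<forall>x\<in>Y. w x \<le> w' x)" and x: "x \<in> Y"
  have fin: "finite {x. e n x \<noteq> 0}" and off: "\<And>x. x \<notin> Y \<Longrightarrow> e n x = 0" for n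
    using e by (auto simp: null_sequence_def)
  have "(w' x - w x) * (e n x)\<^sup>2 \<le> energy b (e n) - (\<Sum>\<^sub>\<infinity>x\<in>Y. w x * (e n x)\<^sup>2)" for n
  proof -
    have summable: "(\<lambda>x. q x * (e n x)\<^sup>2) summable_on Y" for q
      by (rule finite_nonzero_values_imp_summable_on) (rule finite_subset[OF _ fin[of n]], auto)
    have "(w' x - w x) * (e n x)\<^sup>2 = (\<Sum>y\<in>{x}. (w' y - w y) * (e n y)\<^sup>2)"
      by simp
    also have "\<dots> \<le> (\<Sum>\<^sub>\<infinity>y\<in>Y. (w' y - w y) * (e n y)\<^sup>2)"
      using x w' by (intro finite_sum_le_infsum summable) auto
    also have "\<dots> = (\<Sum>\<^sub>\<infinity>y\<in>Y. w' y * (e n y)\<^sup>2) - (\<Sum>\<^sub>\<infinity>y\<in>Y. w y * (e n y)\<^sup>2)"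
      using infsum_add[OF summable[of w'] summable[of "\<lambda>y. - w y"]]
      by (simp add: left_diff_distrib infsum_uminus)
    also have "(\<Sum>\<^sub>\<infinity>y\<in>Y. w' y * (e n y)\<^sup>2) \<le> energy b (e n)"
      using w' fin off by (auto simp: hardy_weight_def)
    finally show ?thesis by simp
  qed
  moreover have "(\<lambda>n. (w' x - w x) * (e n x)\<^sup>2) \<longlonglongrightarrow> (w' x - w x) * (v x)\<^sup>2"
    using e by (intro tendsto_intros) (auto simp: null_sequence_def)
  moreover have "(\<lambda>n. energy b (e n) - (\<Sum>\<^sub>\<infinity>x\<in>Y. w x * (e n x)\<^sup>2)) \<longlonglongrightarrow> 0"
    using e by (simp add: null_sequence_def)
  ultimately have "(w' x - w x) * (v x)\<^sup>2 \<le> 0"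
    by (blast intro: LIMSEQ_le)
  then have "w' x \<le> w x"
    using pos[OF x] by (simp add: mult_le_0_iff)
  then show "w' x = w x"
    using w' x by (auto intro: antisym)
qed

text \<open>
  In the representation with respect to \<open>V\<close>, the term of the single edge \<open>(x, y)\<close> is bounded by the
  deficit of \<open>e n\<close> and hence tends to \<open>0\<close>.
\<close>

lemma ground_state_ratio_eq:
  assumes b: "weighted_graph b" and e: "null_sequence b Y w v e" and V: "ground_state b Y w V"
    and xy: "x \<in> Y" "y \<in> Y" "0 < b x y"
  shows "v x / V x = v y / V y"
proof -
  have V0: "0 \<le> V z" for z
    using V by (cases "z \<in> Y") (auto simp: ground_state_def less_imp_le)
  have Vxy: "0 < V x" "0 < V y"
    using V xy by (auto simp: ground_state_def)
  have "b x y * (V x * V y) * (e n x / V x - e n y / V y)\<^sup>2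
          \<le> 2 * (energy b (e n) - (\<Sum>\<^sub>\<infinity>x\<in>Y. w x * (e n x)\<^sup>2))" for n
  proof -
    have "((\<lambda>(x, y). b x y * (V x * V y) * (e n x / V x - e n y / V y)\<^sup>2) has_sum
             2 * (energy b (e n) - (\<Sum>\<^sub>\<infinity>x\<in>Y. w x * (e n x)\<^sup>2))) UNIV"
      using e by (intro ground_state_representation[OF b V]) (auto simp: null_sequence_def)
    from finite_sum_le_has_sum[OF this, of "{(x, y)}"] show ?thesis
      by (auto simp: weighted_graph_nonneg[OF b] V0)
  qed
  moreover have "(\<lambda>n. b x y * (V x * V y) * (e n x / V x - e n y / V y)\<^sup>2)
      \<longlonglongrightarrow> b x y * (V x * V y) * (v x / V x - v y / V y)\<^sup>2"
    using e Vxy by (intro tendsto_intros) (auto simp: null_sequence_def)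
  moreover have "(\<lambda>n. 2 * (energy b (e n) - (\<Sum>\<^sub>\<infinity>x\<in>Y. w x * (e n x)\<^sup>2))) \<longlonglongrightarrow> 2 * 0"
    using e by (intro tendsto_intros) (auto simp: null_sequence_def)
  ultimately have "b x y * (V x * V y) * (v x / V x - v y / V y)\<^sup>2 \<le> 0"
    by (auto intro: LIMSEQ_le)
  then show ?thesis
    using xy Vxy by (simp add: mult_le_0_iff zero_less_mult_iff)
qed

text \<open>
  Fatou's lemma: finite partial sums of the energy of \<open>v\<close> are limits of those of \<open>e n\<close>, which are
  bounded by the energy of \<open>e n\<close>, that is by \<open>\<Sum> w (e n)\<^sup>2 \<le> \<Sum> w v\<^sup>2\<close> up to the vanishing deficit.
\<close>

lemma energy_le_of_null_sequence:
  assumes b: "weighted_graph b" and w: "\<And>x. x \<in> Y \<Longrightarrow> 0 \<le> w x"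
    and e: "null_sequence b Y w v e" and summable: "(\<lambda>x. w x * (v x)\<^sup>2) summable_on Y"
  shows "(\<lambda>(x, y). b x y * (v x - v y)\<^sup>2) summable_on UNIV"
    and "(\<Sum>\<^sub>\<infinity>(x, y)\<in>UNIV. b x y * (v x - v y)\<^sup>2) \<le> 2 * (\<Sum>\<^sub>\<infinity>x\<in>Y. w x * (v x)\<^sup>2)"
proof -
  let ?W = "\<Sum>\<^sub>\<infinity>x\<in>Y. w x * (v x)\<^sup>2"
  have fin: "finite {x. e n x \<noteq> 0}" for n
    using e by (simp add: null_sequence_def)
  have bound: "(\<Sum>(x, y)\<in>F. b x y * (v x - v y)\<^sup>2) \<le> 2 * ?W" if F: "finite F" for F
  proof (rule LIMSEQ_le)
    show "(\<lambda>n. \<Sum>(x, y)\<in>F. b x y * (e n x - e n y)\<^sup>2) \<longlonglongrightarrow> (\<Sum>(x, y)\<in>F. b x y * (v x - v y)\<^sup>2)"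
      unfolding case_prod_beta using e by (intro tendsto_intros) (auto simp: null_sequence_def)
    have "(\<lambda>n. 2 * (?W + (energy b (e n) - (\<Sum>\<^sub>\<infinity>x\<in>Y. w x * (e n x)\<^sup>2)))) \<longlonglongrightarrow> 2 * (?W + 0)"
      using e by (intro tendsto_intros) (auto simp: null_sequence_def)
    then show "(\<lambda>n. 2 * (?W + (energy b (e n) - (\<Sum>\<^sub>\<infinity>x\<in>Y. w x * (e n x)\<^sup>2)))) \<longlonglongrightarrow> 2 * ?W"
      by simp
    have "(\<Sum>(x, y)\<in>F. b x y * (e n x - e n y)\<^sup>2)
            \<le> 2 * (?W + (energy b (e n) - (\<Sum>\<^sub>\<infinity>x\<in>Y. w x * (e n x)\<^sup>2)))" for n
    proof -
      have "(\<Sum>\<^sub>\<infinity>x\<in>Y. w x * (e n x)\<^sup>2) \<le> ?W"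
      proof (rule infsum_mono[OF _ summable])
        show "(\<lambda>x. w x * (e n x)\<^sup>2) summable_on Y"
          by (rule finite_nonzero_values_imp_summable_on) (rule finite_subset[OF _ fin[of n]], auto)
        show "w x * (e n x)\<^sup>2 \<le> w x * (v x)\<^sup>2" if "x \<in> Y" for x
          using e w[OF that] by (intro mult_left_mono power_mono) (auto simp: null_sequence_def)
      qed
      moreover have "(\<Sum>(x, y)\<in>F. b x y * (e n x - e n y)\<^sup>2) \<le> 2 * energy b (e n)"
        by (intro finite_sum_le_has_sum[OF has_sum_energy[OF b fin]] F)
          (auto simp: weighted_graph_nonneg[OF b])
      ultimately show ?thesis by simp
    qed
    then show "\<exists>N. \<forall>n\<ge>N. (\<Sum>(x, y)\<in>F. b x y * (e n x - e n y)\<^sup>2)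
            \<le> 2 * (?W + (energy b (e n) - (\<Sum>\<^sub>\<infinity>x\<in>Y. w x * (e n x)\<^sup>2)))"
      by blast
  qed
  then show summable: "(\<lambda>(x, y). b x y * (v x - v y)\<^sup>2) summable_on UNIV"
    by (intro nonneg_bdd_above_summable_on bdd_aboveI[of _ "2 * ?W"])
      (auto simp: weighted_graph_nonneg[OF b])
  show "(\<Sum>\<^sub>\<infinity>(x, y)\<in>UNIV. b x y * (v x - v y)\<^sup>2) \<le> 2 * ?W"
    by (intro infsum_le_finite_sums[OF summable] bound)
qed

section \<open>The logarithmic cutoff\<close>

text \<open>
  The factor \<open>\<rho>\<close> serves to reach ground states that are different multiples of \<open>sqrt u\<close> on different
  components of \<open>Y\<close>. Being constant along edges in \<open>Y\<close> and at most \<open>1\<close>, it can only decrease each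
  term of the deficit in the ground state representation.
\<close>

lemma null_sequence_log_cutoff:
  fixes u \<rho> :: "'a::countable \<Rightarrow> real"
  assumes b: "weighted_graph b" and u: "u \<in> formal_domain b" and proper: "proper_function u"
    and harm: "\<And>x. 0 < u x \<Longrightarrow> laplacian b u x = 0" and u0: "\<And>x. 0 \<le> u x"
    and t0: "0 < t0"
    and flux: "(\<lambda>(x, y). b x y * (u x - u y)) summable_on {(x, y). u y < t0 \<and> t0 \<le> u x}"
    and gs: "ground_state b Y w (\<lambda>x. sqrt (u x))"
    and \<rho>: "\<And>x. 0 \<le> \<rho> x" "\<And>x. \<rho> x \<le> 1"
    and edge: "\<And>x y. x \<in> Y \<Longrightarrow> y \<in> Y \<Longrightarrow> 0 < b x y \<Longrightarrow> \<rho> x = \<rho> y"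
  shows "null_sequence b Y w (\<lambda>x. \<rho> x * sqrt (u x))
           (\<lambda>n x. \<rho> x * sqrt (u x) * (1 - \<bar>clamped_ln (Suc n) (u x)\<bar> / Suc n))"
proof -
  define N where "N n = real (Suc n)" for n
  have N: "0 < N n" for n
    by (simp add: N_def)
  define c where "c n = clamped_ln (N n)" for n
  define \<eta> where "\<eta> n x = 1 - \<bar>c n (u x)\<bar> / N n" for n x
  define e where "e n x = \<rho> x * sqrt (u x) * \<eta> n x" for n x
  obtain C where C: "((\<lambda>(x, y). b x y * (u x - u y)) has_sum C) {(x, y). u y < t0 \<and> t0 \<le> u x}"
    using flux by (auto simp: summable_on_def)
  have Y: "x \<in> Y \<longleftrightarrow> 0 < u x" for x
    using gs by (force simp: ground_state_def)
  have off: "u x = 0" if "x \<notin> Y" for x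
    using that Y[of x] u0[of x] by simp
  have c_le: "\<bar>c n t\<bar> \<le> N n" for n t
  proof (cases "0 < t")
    case True
    then show ?thesis using N[of n] by (auto simp: c_def clamped_ln_eq)
  next
    case False
    then have "t \<le> exp (- N n)"
      using exp_gt_zero[of "- N n"] by linarith
    then show ?thesis using N[of n] by (simp add: c_def clamped_ln_below)
  qed
  have \<eta>: "0 \<le> \<eta> n x" "\<eta> n x \<le> 1" for n x
    using c_le[of n "u x"] N[of n] by (auto simp: \<eta>_def field_simps)
  have fin: "finite {x. e n x \<noteq> 0}" for n
  proof (rule finite_subset[OF _ proper_functionD[OF proper, of "exp (- N n)" "exp (N n)"]])
    have "\<eta> n x = 0" if "u x < exp (- N n) \<or> exp (N n) < u x" for x
      using that N[of n] by (auto simp: \<eta>_def c_def clamped_ln_below clamped_ln_above)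
    then show "{x. e n x \<noteq> 0} \<subseteq> {x. exp (- N n) \<le> u x \<and> u x \<le> exp (N n)}"
      by (auto simp: e_def) (meson not_le)+
  qed simp
  have e_off: "e n x = 0" if "x \<notin> Y" for n x
    using off[OF that] by (simp add: e_def)
  have limit: "(\<lambda>n. e n x) \<longlonglongrightarrow> \<rho> x * sqrt (u x)" for x
  proof (cases "x \<in> Y")
    case True
    have lim: "(\<lambda>n. \<bar>ln (u x)\<bar> / N n) \<longlonglongrightarrow> 0"
      unfolding N_def using lim_const_over_n[of "\<bar>ln (u x)\<bar>"] by (rule LIMSEQ_Suc)
    have "\<bar>c n (u x)\<bar> \<le> \<bar>ln (u x)\<bar>" for n
      using True Y N[of n] by (auto simp: c_def clamped_ln_eq)
    then have "norm (\<bar>c n (u x)\<bar> / N n) \<le> \<bar>ln (u x)\<bar> / N n" for n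
      using N[of n] by (simp add: divide_right_mono)
    with lim have "(\<lambda>n. \<bar>c n (u x)\<bar> / N n) \<longlonglongrightarrow> 0"
      by (rule Lim_null_comparison[OF always_eventually, OF allI, rotated])
    then have "(\<lambda>n. \<rho> x * sqrt (u x) * (1 - \<bar>c n (u x)\<bar> / N n)) \<longlonglongrightarrow> \<rho> x * sqrt (u x) * (1 - 0)"
      by (intro tendsto_intros)
    then show ?thesis by (simp add: e_def \<eta>_def)
  qed (simp add: e_def off)
  define \<delta> where "\<delta> n = energy b (e n) - (\<Sum>\<^sub>\<infinity>x\<in>Y. w x * (e n x)\<^sup>2)" for n
  have \<delta>: "0 \<le> \<delta> n \<and> \<delta> n \<le> 2 * C / N n" for n
  proof -
    let ?g = "\<lambda>(x, y). b x y * (sqrt (u x) * sqrt (u y)) * (e n x / sqrt (u x) - e n y / sqrt (u y))\<^sup>2"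
    let ?h = "\<lambda>(x, y). 1 / (N n)\<^sup>2 * (b x y * (u x - u y) * (c n (u x) - c n (u y)))"
    have g: "(?g has_sum 2 * \<delta> n) UNIV"
      unfolding \<delta>_def using fin e_off by (intro ground_state_representation[OF b gs]) auto
    \<comment> \<open>The flux formula grows like \<open>N n\<close>, the height of the clamped logarithm, whereas squaring the
      cutoff has gained a factor \<open>(N n)\<^sup>2\<close>.\<close>
    have "((\<lambda>(x, y). b x y * (u x - u y) * (c n (u x) - c n (u y))) has_sum 2 * C * (N n - - N n)) UNIV"
      by (rule flux_formula[OF b u proper harm t0 C, of "exp (- N n)" _ _ "exp (N n)"])
        (use N[of n] in \<open>auto simp: c_def clamped_ln_below clamped_ln_above\<close>)
    then have "((\<lambda>p. 1 / (N n)\<^sup>2 * (\<lambda>(x, y). b x y * (u x - u y) * (c n (u x) - c n (u y))) p) has_sum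
        1 / (N n)\<^sup>2 * (2 * C * (N n - - N n))) UNIV"
      by (rule has_sum_cmult_right)
    then have h: "(?h has_sum 4 * C / N n) UNIV"
      by (rule has_sum_eqI) (use N[of n] in \<open>auto simp: field_simps power2_eq_square\<close>)
    \<comment> \<open>On edges inside \<open>Y\<close> this is the inequality between the means; elsewhere the left side is \<open>0\<close>,
      and the right side is nonnegative by monotonicity of \<open>c n\<close>.\<close>
    have le: "?g (x, y) \<le> ?h (x, y)" for x y
    proof (cases "x \<in> Y \<and> y \<in> Y \<and> 0 < b x y")
      case True
      then have pos: "0 < u x" "0 < u y" and \<rho>xy: "\<rho> y = \<rho> x"
        using Y edge[of x y] by auto
      have "(e n x / sqrt (u x) - e n y / sqrt (u y))\<^sup>2 = (\<rho> x)\<^sup>2 * (\<eta> n x - \<eta> n y)\<^sup>2"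
        using pos by (simp add: e_def \<rho>xy power_mult_distrib flip: right_diff_distrib)
      also have "\<dots> \<le> 1 * (\<eta> n x - \<eta> n y)\<^sup>2"
        using \<rho>[of x] by (intro mult_right_mono) (auto simp: power_le_one)
      also have "\<dots> = 1 / (N n)\<^sup>2 * (\<bar>c n (u x)\<bar> - \<bar>c n (u y)\<bar>)\<^sup>2"
        using N[of n] by (simp add: \<eta>_def power2_eq_square field_simps)
      finally have "?g (x, y) \<le> b x y * (sqrt (u x) * sqrt (u y)) * (1 / (N n)\<^sup>2 * (\<bar>c n (u x)\<bar> - \<bar>c n (u y)\<bar>)\<^sup>2)"
        using u0 unfolding prod.case by (intro mult_left_mono) (auto simp: weighted_graph_nonneg[OF b])
      also have "\<dots> = b x y / (N n)\<^sup>2 * (sqrt (u x) * sqrt (u y) * (\<bar>c n (u x)\<bar> - \<bar>c n (u y)\<bar>)\<^sup>2)"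
        by simp
      also have "\<dots> \<le> b x y / (N n)\<^sup>2 * ((u x - u y) * (c n (u x) - c n (u y)))"
        unfolding c_def using u0 by (intro mult_left_mono sqrt_mult_clamped_ln_diff_le)
          (auto simp: weighted_graph_nonneg[OF b])
      finally show ?thesis by simp
    next
      case False
      then have g0: "?g (x, y) = 0"
        using off weighted_graph_nonneg[OF b, of x y] by auto
      have "0 \<le> (u x - u y) * (c n (u x) - c n (u y))"
        unfolding c_def using clamped_ln_mono[of "u x" "u y" "N n"] clamped_ln_mono[of "u y" "u x" "N n"]
        by (cases "u x \<le> u y") (auto simp: zero_le_mult_iff)
      then have "0 \<le> ?h (x, y)"
        using weighted_graph_nonneg[OF b, of x y] by (simp add: mult.assoc)
      with g0 show ?thesis
        by (rule ord_eq_le_trans)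
    qed
    have "2 * \<delta> n \<le> 4 * C / N n"
      by (rule has_sum_mono[OF g h]) (use le in auto)
    moreover have "0 \<le> 2 * \<delta> n"
      by (rule has_sum_nonneg[OF g]) (auto simp: weighted_graph_nonneg[OF b] u0)
    ultimately show ?thesis by simp
  qed
  have "\<delta> \<longlonglongrightarrow> 0"
  proof (rule tendsto_sandwich[of "\<lambda>_. 0"])
    show "(\<lambda>n. 2 * C / N n) \<longlonglongrightarrow> 0"
      unfolding N_def using lim_const_over_n[of "2 * C"] by (rule LIMSEQ_Suc)
  qed (use \<delta> in auto)
  moreover have "0 \<le> e n x \<and> e n x \<le> \<rho> x * sqrt (u x)" for n x
    using \<rho>[of x] \<eta>[of n x] u0[of x] by (auto simp: e_def mult_left_le)
  ultimately have "null_sequence b Y w (\<lambda>x. \<rho> x * sqrt (u x)) e"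
    using fin e_off limit by (simp add: null_sequence_def \<delta>_def[abs_def])
  then show ?thesis
    by (simp add: e_def[abs_def] \<eta>_def[abs_def] c_def N_def)
qed

section \<open>Null-criticality\<close>

text \<open>
  From \<open>2 sqrt (u x) (sqrt (u x) - sqrt (u y)) = (sqrt (u x) - sqrt (u y))\<^sup>2 + (u x - u y)\<close>, where the last
  summand drops out because \<open>u\<close> is harmonic at \<open>x\<close>.
\<close>

lemma has_sum_sqrt_harmonic:
  assumes b: "weighted_graph b" and u: "u \<in> formal_domain b"
    and u0: "\<And>x. 0 \<le> u x" and harm: "laplacian b u x = 0"
  shows "((\<lambda>y. b x y * (sqrt (u x) - sqrt (u y))\<^sup>2) has_sum
           2 * sqrt (u x) * laplacian b (\<lambda>y. sqrt (u y)) x) UNIV"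
proof -
  have sq: "sqrt (u y) * sqrt (u y) = u y" "sqrt (u y) * (sqrt (u y) * r) = u y * r" for y r
    using u0[of y] by (simp_all flip: mult.assoc)
  have 1: "((\<lambda>y. b x y * (u x - u y)) has_sum 0) UNIV"
    using has_sum_laplacian[OF b u, of x] harm by simp
  show ?thesis
    using has_sum_add[OF has_sum_cmult_right[OF has_sum_laplacian[OF b sqrt_in_formal_domain[OF b u]],
          of "2 * sqrt (u x)"] has_sum_uminusI[OF 1]]
    by (rule has_sum_eqI) (auto simp: power2_eq_square algebra_simps sq u0)
qed

lemma boundary_edge:
  assumes "connected_graph b" "x \<notin> K" "y \<in> K"
  obtains p q where "p \<notin> K" "q \<in> K" "0 < b p q"
proof -
  obtain ys where "ys \<noteq> []" "hd ys = x" "last ys = y" "successively (\<lambda>z z'. b z z' > 0) ys"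
    using assms(1) unfolding connected_graph_def by metis
  then have "\<exists>p q. p \<notin> K \<and> q \<in> K \<and> 0 < b p q"
    using assms(2)
  proof (induction ys arbitrary: x)
    case (Cons z zs)
    then show ?case
      using assms(3) by (cases zs) auto
  qed simp
  then show ?thesis using that by blast
qed

theorem theorem3:
  fixes b :: "'a::countable \<Rightarrow> 'a \<Rightarrow> real"
    and K :: "'a set"
    and u :: "'a \<Rightarrow> real"
  assumes "weighted_graph b"
    and "connected_graph b"
    and "K \<noteq> {}"
    and "K \<noteq> UNIV"
    and "u \<in> formal_domain b"
    and "\<And>x. x \<notin> K \<Longrightarrow> 0 < u x"
    and "\<And>x. x \<in> K \<Longrightarrow> u x = 0"
    and "\<And>x. x \<notin> K \<Longrightarrow> laplacian b u x = 0"
    and "proper_function u"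
    and "\<exists>t0>0. (\<lambda>(x, y). b x y * (u x - u y)) summable_on {(x, y). u y < t0 \<and> t0 \<le> u x}"
  shows "null_critical_hardy_weight b (UNIV - K)
           (\<lambda>x. laplacian b (\<lambda>y. sqrt (u y)) x / sqrt (u x))"
proof -
  note b = assms(1)
  define Y where "Y = UNIV - K"
  define v where "v x = sqrt (u x)" for x
  define w where "w x = laplacian b v x / v x" for x
  have u0: "0 \<le> u x" for x
    using assms(6,7)[of x] by (cases "x \<in> K") auto
  have harm: "laplacian b u x = 0" if "0 < u x" for x
    using assms(7,8)[of x] that by auto
  obtain t0 where t0: "0 < t0"
    and flux: "(\<lambda>(x, y). b x y * (u x - u y)) summable_on {(x, y). u y < t0 \<and> t0 \<le> u x}"
    using assms(10) by blast
  have v_pos: "0 < v x" if "x \<in> Y" for x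
    using assms(6) that by (simp add: v_def Y_def)
  have v_off: "v x = 0" if "x \<notin> Y" for x
    using assms(7) that by (simp add: v_def Y_def)
  have eq: "laplacian b v x = w x * v x" if "x \<in> Y" for x
    using v_pos[OF that] by (simp add: w_def)
  have gs: "ground_state b Y w v"
    using sqrt_in_formal_domain[OF b assms(5)] v_pos v_off eq
    by (simp add: ground_state_def v_def[abs_def])
  have row: "((\<lambda>y. b x y * (v x - v y)\<^sup>2) has_sum 2 * (w x * (v x)\<^sup>2)) UNIV" if "x \<in> Y" for x
    using has_sum_sqrt_harmonic[OF b assms(5) u0 assms(8), of x, folded v_def] that eq[OF that]
    by (simp add: Y_def power2_eq_square mult_ac)
  have null: "null_sequence b Y w (\<lambda>x. \<rho> x * v x)
      (\<lambda>n x. \<rho> x * v x * (1 - \<bar>clamped_ln (Suc n) (u x)\<bar> / Suc n))"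
    if "\<And>x. 0 \<le> \<rho> x" "\<And>x. \<rho> x \<le> 1" "\<And>x y. x \<in> Y \<Longrightarrow> y \<in> Y \<Longrightarrow> 0 < b x y \<Longrightarrow> \<rho> x = \<rho> y" for \<rho>
    using null_sequence_log_cutoff[OF b assms(5,9) harm u0 t0 flux gs[unfolded v_def[abs_def]] that]
    by (simp add: v_def)
  obtain e where e: "null_sequence b Y w v e"
    using null[of "\<lambda>_. 1"] by auto
  obtain p q where pq: "p \<in> Y" "q \<notin> Y" "0 < b p q"
  proof -
    obtain x y where "x \<notin> K" "y \<in> K"
      using assms(3,4) by auto
    with boundary_edge[OF assms(2)] show ?thesis
      using that by (metis DiffI DiffD2 UNIV_I Y_def)
  qed
  have w_nonneg: "0 \<le> w x" if "x \<in> Y" for x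
    using has_sum_nonneg[OF row[OF that]] v_pos[OF that]
    by (simp add: weighted_graph_nonneg[OF b] zero_le_mult_iff)
  have "w p \<noteq> 0"
  proof -
    have "b p q * (v p - v q)\<^sup>2 \<le> 2 * (w p * (v p)\<^sup>2)"
      using finite_sum_le_has_sum[OF row[OF pq(1)], of "{q}"] by (simp add: weighted_graph_nonneg[OF b])
    then show ?thesis
      using pq v_pos[OF pq(1)] v_off[OF pq(2)] by (auto simp: mult_le_0_iff)
  qed
  then have "critical_hardy_weight b Y w"
    using w_nonneg pq(1) hardy_weight_if_ground_state[OF b gs]
    by (intro critical_if_null_sequence[OF _ e v_pos]) auto
  moreover have "\<not> (\<lambda>x. w x * (V x)\<^sup>2) summable_on Y" if V: "ground_state b Y w V" for V
  proof
    assume V_summable: "(\<lambda>x. w x * (V x)\<^sup>2) summable_on Y"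
    have V_pos: "0 < V x" if "x \<in> Y" for x
      using V that by (simp add: ground_state_def)
    \<comment> \<open>\<open>V / v\<close> may be unbounded over the components of \<open>Y\<close>, so it is truncated at \<open>1\<close>.\<close>
    define \<rho> where "\<rho> x = (if x \<in> Y then min 1 (V x / v x) else 0)" for x
    define v' where "v' x = \<rho> x * v x" for x
    have \<rho>: "0 \<le> \<rho> x" "\<rho> x \<le> 1" for x
      using V_pos[of x] v_pos[of x] by (auto simp: \<rho>_def less_imp_le)
    have \<rho>_edge: "\<rho> x = \<rho> y" if "x \<in> Y" "y \<in> Y" "0 < b x y" for x y
    proof -
      have "V x / v x = V y / v y"
        using ground_state_ratio_eq[OF b e V that] by (metis inverse_divide)
      then show ?thesis using that by (simp add: \<rho>_def)
    qed
    have v'_pos: "0 < v' x" and v'_le: "v' x \<le> V x" if "x \<in> Y" for x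
      using that v_pos[OF that] V_pos[OF that] by (auto simp: v'_def \<rho>_def min_def field_simps)
    have v'_summable: "(\<lambda>x. w x * (v' x)\<^sup>2) summable_on Y"
      by (rule summable_on_comparison_test[OF V_summable])
        (use w_nonneg less_imp_le[OF v'_pos] v'_le in \<open>auto intro!: mult_left_mono power_mono\<close>)
    let ?W = "\<Sum>\<^sub>\<infinity>x\<in>Y. w x * (v' x)\<^sup>2"
    let ?g = "\<lambda>(x, y). b x y * (v' x - v' y)\<^sup>2"
    obtain e' where "null_sequence b Y w v' e'"
      using null[of \<rho>] \<rho> \<rho>_edge unfolding v'_def[abs_def] by blast
    note g = energy_le_of_null_sequence[OF b w_nonneg this v'_summable]
    \<comment> \<open>As \<open>\<rho>\<close> is constant along edges in \<open>Y\<close> and \<open>v\<close> vanishes on \<open>K\<close>, multiplication by \<open>\<rho>\<close> acts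
      on each row as multiplication by the number \<open>\<rho> x\<close>.\<close>
    have row': "((\<lambda>y. ?g (x, y)) has_sum 2 * (w x * (v' x)\<^sup>2)) UNIV" if "x \<in> Y" for x
    proof (rule has_sum_eqI[OF has_sum_cmult_right[OF row[OF that], of "(\<rho> x)\<^sup>2"]])
      fix y
      have "b x y = 0 \<or> v' y = \<rho> x * v y"
        using \<rho>_edge[OF that, of y] v_off[of y] weighted_graph_nonneg[OF b, of x y]
        by (cases "y \<in> Y") (auto simp: v'_def)
      then show "(\<rho> x)\<^sup>2 * (b x y * (v x - v y)\<^sup>2) = ?g (x, y)"
        by (auto simp: v'_def power_mult_distrib simp flip: right_diff_distrib)
    qed (simp add: v'_def power_mult_distrib)
    have gY: "(?g has_sum infsum ?g (Y \<times> UNIV)) (Y \<times> UNIV)"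
      using summable_on_subset_banach[OF g(1)] by simp
    have "((\<lambda>x. 2 * (w x * (v' x)\<^sup>2)) has_sum infsum ?g (Y \<times> UNIV)) Y"
      by (rule has_sum_Sigma'[OF gY row'])
    moreover have "((\<lambda>x. 2 * (w x * (v' x)\<^sup>2)) has_sum 2 * ?W) Y"
      using v'_summable by (intro has_sum_cmult_right) simp
    ultimately have "infsum ?g (Y \<times> UNIV) = 2 * ?W"
      by (rule has_sum_unique)
    \<comment> \<open>The boundary edge, traversed from \<open>K\<close> to \<open>Y\<close>, is missing on the left.\<close>
    moreover have "infsum ?g (Y \<times> UNIV) < infsum ?g UNIV"
      by (rule has_sum_strict_mono_neutral[OF gY has_sum_infsum[OF g(1)], of "(q, p)"])
        (use pq v'_pos[OF pq(1)] v_off[OF pq(2)] weighted_graph_sym[OF b, of p q]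
          in \<open>auto simp: weighted_graph_nonneg[OF b] v'_def[of q]\<close>)
    ultimately show False
      using g(2) by simp
  qed
  ultimately have "null_critical_hardy_weight b Y w"
    by (simp add: null_critical_hardy_weight_def)
  then show ?thesis
    by (simp add: Y_def w_def[abs_def] v_def[abs_def])
qed

end
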